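(* Let $k$ be a field of characteristic $p> 0$, and let $d_1, \ldots, d_n, a$ be positive integers such that $d_i \le p^a$ for $i=1, \ldots, n-2$. Let $A=k[x_1, \ldots, x_n]/(x_1^{d_1}, \ldots, x_n^{d_n})$ and, for a positive integer $b$, let \[ B_b=k[x_1, \ldots, x_n]/(x_1^{d_1}, \ldots, x_{n-2}^{d_{n-2}}, x_{n-1}^{d_{n-1}+bp^a}, x_n^{d_n+bp^a}). \] Then for every positive integer $b$: if $B_b$ has the weak Lefschetz property, then $A$ has the weak Lefschetz property. If, in addition, $d_{n-1}+d_n\ge\sum_{i=1}^{n-2}(d_i-1)$, then for every positive integer $b$, $A$ has the weak Lefschetz property if and only if $B_b$ does.
   Context: Algebras are graded by degree, $A=\bigoplus_{i\ge0}A_i$. A graded artinian algebra $A$ has the weak Lefschetz property if there is a linear form $\ell\in A_1$ such that for every $i$ the map $A_i\to A_{i+1}$, $a\mapsto \ell a$, is injective or surjective. *)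

theory Defs
  imports Main "HOL-Library.Poly_Mapping"
begin

text \<open>Multivariate polynomials over 'k: finitely supported maps from monomials
(exponent vectors, finitely supported nat-to-nat maps, variable x_j has index j) to coefficients,
with convolution product (Poly_Mapping).  k[x_1,...,x_n] is the subring of
polynomials whose monomials only involve variables 1..n.\<close>

type_synonym 'k mpoly = "(nat \<Rightarrow>\<^sub>0 nat) \<Rightarrow>\<^sub>0 'k"

definition Var :: "nat \<Rightarrow> 'k::zero_neq_one mpoly" where
  "Var j = Poly_Mapping.single (Poly_Mapping.single j 1) 1"

definition mon_deg :: "(nat \<Rightarrow>\<^sub>0 nat) \<Rightarrow> nat" where
  "mon_deg m = (\<Sum>j\<in>Poly_Mapping.keys m. Poly_Mapping.lookup m j)"

definition in_vars :: "nat \<Rightarrow> 'k::zero mpoly \<Rightarrow> bool" where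
  "in_vars n f \<longleftrightarrow> (\<forall>m\<in>Poly_Mapping.keys f. Poly_Mapping.keys m \<subseteq> {1..n})"

definition homog :: "nat \<Rightarrow> 'k::zero mpoly \<Rightarrow> bool" where
  "homog i f \<longleftrightarrow> (\<forall>m\<in>Poly_Mapping.keys f. mon_deg m = i)"

definition mci_ideal :: "nat \<Rightarrow> (nat \<Rightarrow> nat) \<Rightarrow> 'k::comm_ring_1 mpoly set" where
  "mci_ideal n e = {f. \<exists>q. (\<forall>j\<in>{1..n}. in_vars n (q j)) \<and>
                          f = (\<Sum>j=1..n. q j * Var j ^ e j)}"

definition linform :: "nat \<Rightarrow> (nat \<Rightarrow> 'k::comm_ring_1) \<Rightarrow> 'k mpoly" where
  "linform n c = (\<Sum>j=1..n. Poly_Mapping.single (Poly_Mapping.single j 1) (c j))"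

definition mult_inj :: "nat \<Rightarrow> (nat \<Rightarrow> nat) \<Rightarrow> 'k::comm_ring_1 mpoly \<Rightarrow> nat \<Rightarrow> bool" where
  "mult_inj n e l i \<longleftrightarrow>
     (\<forall>f. in_vars n f \<and> homog i f \<and> l * f \<in> mci_ideal n e \<longrightarrow> f \<in> mci_ideal n e)"

definition mult_surj :: "nat \<Rightarrow> (nat \<Rightarrow> nat) \<Rightarrow> 'k::comm_ring_1 mpoly \<Rightarrow> nat \<Rightarrow> bool" where
  "mult_surj n e l i \<longleftrightarrow>
     (\<forall>g. in_vars n g \<and> homog (i + 1) g \<longrightarrow>
        (\<exists>f. in_vars n f \<and> homog i f \<and> g - l * f \<in> mci_ideal n e))"

definition WLP :: "'k::field itself \<Rightarrow> nat \<Rightarrow> (nat \<Rightarrow> nat) \<Rightarrow> bool" where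
  "WLP _ n e \<longleftrightarrow> (\<exists>c::nat \<Rightarrow> 'k. \<forall>i.
      mult_inj n e (linform n c) i \<or> mult_surj n e (linform n c) i)"

end

theory Submission
  imports Defs Complex_Main "HOL-Computational_Algebra.Primes"
begin

text \<open>
  The quotient by \<open>(x\<^sub>1\<^bsup>e\<^sub>1\<^esup>, \<dots>, x\<^sub>n\<^bsup>e\<^sub>n\<^esup>)\<close> is Gorenstein: taking the coefficient of its socle monomial, of
  degree \<open>N = \<Sum>(e\<^sub>j - 1)\<close>, makes injectivity of a linear form in degree \<open>i\<close> equivalent to
  surjectivity in degree \<open>N - 1 - i\<close>. As surjectivity propagates upwards, the weak Lefschetz
  property says exactly that some linear form is surjective in the middle degree \<open>N div 2\<close>.
  A degeneration argument along the \<open>x\<^sub>j\<close>-degree allows us to replace a zero coefficient of that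
  linear form by \<open>1\<close>, over any field.

  Passing from \<open>A\<close> to \<open>B\<^sub>b\<close> moves the middle degree by exactly \<open>b p\<^sup>a\<close>. Write \<open>x, y\<close> for the last two
  variables. As \<open>d\<^sub>i \<le> p\<^sup>a\<close>, the Frobenius power \<open>l\<close> to the \<open>p\<^sup>a\<close> shows that the powers of \<open>y\<close> and of \<open>x\<close>
  with exponent \<open>b p\<^sup>a\<close> agree up to a unit modulo \<open>l\<close> and the first \<open>n - 2\<close> relations. So modulo \<open>l\<close>
  the ideal of \<open>B\<^sub>b\<close> is the ideal of \<open>A\<close> multiplied by that power of \<open>x\<close>, a nonzerodivisor.
  Surjectivity thus descends from \<open>B\<^sub>b\<close> to \<open>A\<close>; it ascends when every monomial of the middle degree
  of \<open>B\<^sub>b\<close> without \<open>y\<close> is divisible by that power of \<open>x\<close>, which the numerical condition ensures.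
\<close>

section \<open>Monomial ideals\<close>

abbreviation lookup :: "('a \<Rightarrow>\<^sub>0 'b::zero) \<Rightarrow> 'a \<Rightarrow> 'b" where "lookup \<equiv> Poly_Mapping.lookup"
abbreviation keys :: "('a \<Rightarrow>\<^sub>0 'b::zero) \<Rightarrow> 'a set" where "keys \<equiv> Poly_Mapping.keys"
abbreviation single :: "'a \<Rightarrow> 'b \<Rightarrow> ('a \<Rightarrow>\<^sub>0 'b::zero)" where "single \<equiv> Poly_Mapping.single"
abbreviation monomial :: "(nat \<Rightarrow>\<^sub>0 nat) \<Rightarrow> 'k::zero_neq_one mpoly" where "monomial m \<equiv> single m 1"

text \<open>The ideal generated by the powers x_j^(e j), j in \<open>S\<close>, in the ring with all
  variables, encoded by supports so that no cofactors have to be carried along. The set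
  \<open>S\<close> varies because the argument also works with the first n - 2 relations
  alone.\<close>

definition mono_ideal :: "nat set \<Rightarrow> (nat \<Rightarrow> nat) \<Rightarrow> 'k::comm_ring_1 mpoly set" where
  "mono_ideal S e = {f. \<forall>m\<in>keys f. \<exists>j\<in>S. e j \<le> lookup m j}"

definition lin_ideal :: "nat set \<Rightarrow> (nat \<Rightarrow> nat) \<Rightarrow> 'k::comm_ring_1 mpoly \<Rightarrow> 'k mpoly set" where
  "lin_ideal S e l = {g. \<exists>f. g - l * f \<in> mono_ideal S e}"

definition is_ideal :: "'a::comm_ring_1 set \<Rightarrow> bool" where
  "is_ideal I \<longleftrightarrow> 0 \<in> I \<and> (\<forall>f\<in>I. \<forall>g\<in>I. f + g \<in> I) \<and> (\<forall>f\<in>I. \<forall>g. g * f \<in> I)"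

definition mon_in :: "nat \<Rightarrow> nat \<Rightarrow> (nat \<Rightarrow>\<^sub>0 nat) \<Rightarrow> bool" where
  "mon_in n i m \<longleftrightarrow> keys m \<subseteq> {1..n} \<and> mon_deg m = i"

definition restr :: "('a \<Rightarrow> bool) \<Rightarrow> ('a \<Rightarrow>\<^sub>0 'b::comm_monoid_add) \<Rightarrow> ('a \<Rightarrow>\<^sub>0 'b)" where
  "restr Q f = (\<Sum>m\<in>{m\<in>keys f. Q m}. single m (lookup f m))"

lemma lookup_restr: "lookup (restr Q f) m = (if Q m then lookup f m else 0)"
proof -
  have "lookup (restr Q f) m = (\<Sum>m'\<in>{m\<in>keys f. Q m}. if m' = m then lookup f m else 0)"
    unfolding restr_def lookup_sum by (intro sum.cong) (auto simp: lookup_single when_def)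
  also have "\<dots> = (if Q m then lookup f m else 0)"
    by (subst sum.delta) (auto simp: in_keys_iff)
  finally show ?thesis .
qed

lemma restr_True [simp]: "restr (\<lambda>_. True) f = f"
  by (rule poly_mapping_eqI) (simp add: lookup_restr)

lemma sum_single_keys: "(\<Sum>m\<in>keys f. single m (lookup f m)) = f"
  using restr_True[of f] unfolding restr_def by simp

lemma keys_restr: "keys (restr Q f) = {m\<in>keys f. Q m}"
  by (auto simp: in_keys_iff lookup_restr split: if_splits)

lemma restr_diff: "restr Q (f - g) = restr Q f - restr Q (g :: 'a \<Rightarrow>\<^sub>0 'b::ab_group_add)"
  by (rule poly_mapping_eqI) (simp add: lookup_restr lookup_minus)

lemma restr_id: "(\<And>m. m \<in> keys f \<Longrightarrow> Q m) \<Longrightarrow> restr Q f = f"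
  by (rule poly_mapping_eqI) (auto simp: lookup_restr in_keys_iff)

lemma restr_single: "Q m \<Longrightarrow> restr Q (single m a) = single m a"
  by (rule restr_id) (auto split: if_splits)

lemma restr_mono_ideal: "f \<in> mono_ideal S e \<Longrightarrow> restr Q f \<in> mono_ideal S e"
  by (auto simp: mono_ideal_def keys_restr)

lemma lookup_single_mult:
  fixes f :: "'k::comm_ring_1 mpoly"
  shows "lookup (single s c * f) (s + m) = c * lookup f m"
proof -
  have "single s c * f = (\<Sum>m\<in>keys f. single (s + m) (c * lookup f m))"
    by (subst (1) sum_single_keys[of f, symmetric]) (simp add: sum_distrib_left mult_single)
  then have "lookup (single s c * f) (s + m) =
      (\<Sum>m'\<in>keys f. if m' = m then c * lookup f m else 0)"
    by (auto simp: lookup_sum lookup_single when_def intro: sum.cong)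
  also have "\<dots> = c * lookup f m"
    by (subst sum.delta) (auto simp: in_keys_iff)
  finally show ?thesis .
qed

lemma keys_single_mult: "keys (single s c * f) \<subseteq> (+) s ` keys (f :: 'k::comm_ring_1 mpoly)"
  using keys_mult[of "single s c" f] by (auto split: if_splits)

lemma lookup_single_mult':
  fixes f :: "'k::comm_ring_1 mpoly"
  assumes "\<And>m. \<mu> \<noteq> s + m"
  shows "lookup (single s c * f) \<mu> = 0"
  using keys_single_mult[of s c f] assms by (fastforce simp: in_keys_iff)

lemma single_add_diff:
  "k \<le> lookup m j \<Longrightarrow> single j k + (m - single j k) = (m :: nat \<Rightarrow>\<^sub>0 nat)"
  by (rule poly_mapping_eqI) (auto simp: lookup_add lookup_minus lookup_single when_def)

lemma single1_add_diff:
  "0 < lookup m j \<Longrightarrow> single j 1 + (m - single j 1) = (m :: nat \<Rightarrow>\<^sub>0 nat)"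
  by (rule single_add_diff) simp

lemma lookup_linform_mult:
  fixes f :: "'k::comm_ring_1 mpoly"
  shows "lookup (linform n c * f) \<mu> =
    (\<Sum>j=1..n. if 0 < lookup \<mu> j then c j * lookup f (\<mu> - single j 1) else 0)"
proof -
  have "lookup (single (single j 1) (c j) * f) \<mu> =
      (if 0 < lookup \<mu> j then c j * lookup f (\<mu> - single j 1) else 0)" for j
  proof (cases "0 < lookup \<mu> j")
    case True
    then show ?thesis
      using lookup_single_mult[of "single j 1" "c j" f "\<mu> - single j 1"] single1_add_diff[of \<mu> j]
      by simp
  next
    case False
    then show ?thesis
      by (subst lookup_single_mult') (auto simp: lookup_add)
  qed
  then show ?thesis
    by (simp add: linform_def sum_distrib_right lookup_sum)
qed

text \<open>Multiplication by the form moves monomials only along variables with nonzero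
  coefficient. Exempting the indices with \<open>c j = 0\<close> lets the lemma cut out pieces by
  x_j-degree as well as by total degree.\<close>

lemma restr_linform_mult:
  fixes f :: "'k::comm_ring_1 mpoly"
  assumes "\<And>m j. j \<in> {1..n} \<Longrightarrow> c j \<noteq> 0 \<Longrightarrow> Q' (single j 1 + m) = Q m"
  shows "restr Q' (linform n c * f) = linform n c * restr Q f"
proof (rule poly_mapping_eqI)
  fix \<mu>
  have "(if Q' \<mu> then if 0 < lookup \<mu> j then c j * lookup f (\<mu> - single j 1) else 0 else 0) =
        (if 0 < lookup \<mu> j then c j * (if Q (\<mu> - single j 1) then lookup f (\<mu> - single j 1) else 0) else 0)"
    if "j \<in> {1..n}" for j
    using assms[OF that, of "\<mu> - single j 1"] single1_add_diff[of \<mu> j]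
    by (cases "c j = 0") auto
  then have "(\<Sum>j=1..n. if Q' \<mu> then if 0 < lookup \<mu> j then c j * lookup f (\<mu> - single j 1) else 0 else 0) =
    (\<Sum>j=1..n. if 0 < lookup \<mu> j then c j * (if Q (\<mu> - single j 1) then lookup f (\<mu> - single j 1) else 0) else 0)"
    by (intro sum.cong) auto
  then show "lookup (restr Q' (linform n c * f)) \<mu> = lookup (linform n c * restr Q f) \<mu>"
    by (cases "Q' \<mu>") (simp_all add: lookup_restr lookup_linform_mult cong: if_cong)
qed

lemma mon_deg_add: "mon_deg (a + b) = mon_deg a + mon_deg b"
proof -
  have *: "mon_deg m = (\<Sum>j\<in>K. lookup m j)" if "finite K" "keys m \<subseteq> K" for m K
    unfolding mon_deg_def using that by (intro sum.mono_neutral_left) (auto simp: in_keys_iff)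
  let ?K = "keys a \<union> keys b"
  have "keys (a + b) \<subseteq> ?K" by (rule keys_add)
  then show ?thesis
    by (simp add: *[of ?K] lookup_add sum.distrib)
qed

lemma mon_deg_single [simp]: "mon_deg (single j k) = k"
  by (auto simp: mon_deg_def)

lemma keys_add_nat: "keys (a + b) = keys a \<union> keys (b :: nat \<Rightarrow>\<^sub>0 nat)"
  by (auto simp: in_keys_iff lookup_add)

lemma keys_diff_nat: "keys (a - b) \<subseteq> keys (a :: nat \<Rightarrow>\<^sub>0 nat)"
  by (auto simp: in_keys_iff lookup_minus)

lemma mon_in_single_add:
  "j \<in> {1..n} \<Longrightarrow> mon_in n (k + i) (single j k + m) \<longleftrightarrow> mon_in n i m"
  by (auto simp: mon_in_def mon_deg_add keys_add_nat split: if_splits)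

lemma mon_deg_eq: "keys m \<subseteq> {1..n} \<Longrightarrow> mon_deg m = (\<Sum>j=1..n. lookup m j)"
  unfolding mon_deg_def by (intro sum.mono_neutral_left) (auto simp: in_keys_iff)

section \<open>Ideals and membership tests on monomials\<close>

lemma is_idealD:
  assumes "is_ideal I"
  shows "0 \<in> I" "\<And>f g. f \<in> I \<Longrightarrow> g \<in> I \<Longrightarrow> f + g \<in> I" "\<And>f g. f \<in> I \<Longrightarrow> g * f \<in> I"
    "\<And>f g. f \<in> I \<Longrightarrow> f * g \<in> I"
    "\<And>f. f \<in> I \<Longrightarrow> - f \<in> I" "\<And>f g. f \<in> I \<Longrightarrow> g \<in> I \<Longrightarrow> f - g \<in> I"
proof -
  show *: "0 \<in> I" "\<And>f g. f \<in> I \<Longrightarrow> g \<in> I \<Longrightarrow> f + g \<in> I" "\<And>f g. f \<in> I \<Longrightarrow> g * f \<in> I"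
    using assms by (auto simp: is_ideal_def)
  then show "\<And>f g. f \<in> I \<Longrightarrow> f * g \<in> I" by (simp add: mult.commute)
  show neg: "- f \<in> I" if "f \<in> I" for f using *(3)[OF that, of "-1"] by simp
  show "f - g \<in> I" if "f \<in> I" "g \<in> I" for f g using *(2)[OF that(1) neg[OF that(2)]] by simp
qed

lemma is_ideal_sum: "is_ideal I \<Longrightarrow> (\<And>x. x \<in> A \<Longrightarrow> f x \<in> I) \<Longrightarrow> sum f A \<in> I"
  by (induction A rule: infinite_finite_induct) (auto simp: is_idealD)

lemma single_mult_monomial: "single m c = single 0 c * (monomial m :: 'k::comm_ring_1 mpoly)"
  by (simp add: mult_single)

lemma is_ideal_monomials:
  fixes f :: "'k::comm_ring_1 mpoly"
  assumes "is_ideal I" "\<And>m. m \<in> keys f \<Longrightarrow> monomial m \<in> I"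
  shows "f \<in> I"
proof -
  have "(\<Sum>m\<in>keys f. single m (lookup f m)) \<in> I"
    by (intro is_ideal_sum assms(1))
      (subst single_mult_monomial, rule is_idealD(3)[OF assms(1)], rule assms(2))
  then show ?thesis by (simp add: sum_single_keys)
qed

lemma is_ideal_mono_ideal: "is_ideal (mono_ideal S e :: 'k::comm_ring_1 mpoly set)"
  unfolding is_ideal_def
proof (intro conjI ballI allI)
  show "(0 :: 'k mpoly) \<in> mono_ideal S e" by (simp add: mono_ideal_def)
next
  fix f g :: "'k mpoly" assume "f \<in> mono_ideal S e" "g \<in> mono_ideal S e"
  then show "f + g \<in> mono_ideal S e"
    using keys_add[of f g] by (fastforce simp: mono_ideal_def)
next
  fix f g :: "'k mpoly" assume f: "f \<in> mono_ideal S e"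
  show "g * f \<in> mono_ideal S e"
    unfolding mono_ideal_def
  proof safe
    fix m assume "m \<in> keys (g * f)"
    then obtain a b where ab: "m = a + b" "b \<in> keys f" using keys_mult[of g f] by auto
    then obtain j where "j \<in> S" "e j \<le> lookup b j" using f by (auto simp: mono_ideal_def)
    then show "\<exists>j\<in>S. e j \<le> lookup m j" using ab by (auto simp: lookup_add intro: trans_le_add2)
  qed
qed

lemma is_ideal_lin_ideal: "is_ideal (lin_ideal S e l :: 'k::comm_ring_1 mpoly set)"
  unfolding is_ideal_def
proof (intro conjI ballI allI)
  note I = is_idealD[OF is_ideal_mono_ideal[of S e, where 'k='k]]
  show "(0 :: 'k mpoly) \<in> lin_ideal S e l"
    unfolding lin_ideal_def by (auto intro!: exI[of _ 0] I(1))
  fix f g :: "'k mpoly" assume f: "f \<in> lin_ideal S e l"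
  then obtain f' where f': "f - l * f' \<in> mono_ideal S e" by (auto simp: lin_ideal_def)
  show "g * f \<in> lin_ideal S e l"
    unfolding lin_ideal_def using I(3)[OF f', of g]
    by (auto intro!: exI[of _ "g * f'"] simp: algebra_simps)
  assume g: "g \<in> lin_ideal S e l"
  then obtain g' where g': "g - l * g' \<in> mono_ideal S e" by (auto simp: lin_ideal_def)
  show "f + g \<in> lin_ideal S e l"
    unfolding lin_ideal_def using I(2)[OF f' g']
    by (auto intro!: exI[of _ "f' + g'"] simp: algebra_simps)
qed

lemma mono_ideal_sub_lin_ideal: "f \<in> mono_ideal S e \<Longrightarrow> f \<in> lin_ideal S e l"
  unfolding lin_ideal_def by (auto intro: exI[of _ 0])

lemma mult_in_lin_ideal: "l * f \<in> lin_ideal S e l"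
  unfolding lin_ideal_def by (auto intro!: exI[of _ f] is_idealD(1) is_ideal_mono_ideal)

lemma monomial_in_mono_ideal [simp]:
  "monomial m \<in> mono_ideal S e \<longleftrightarrow> (\<exists>j\<in>S. e j \<le> lookup m j)"
  by (auto simp: mono_ideal_def)

lemma Var_power: "Var j ^ k = (monomial (single j k) :: 'k::comm_ring_1 mpoly)"
  by (induction k) (auto simp: Var_def mult_single single_add[symmetric])

lemma in_vars_add: "in_vars n f \<Longrightarrow> in_vars n g \<Longrightarrow> in_vars n (f + g)"
  using keys_add[of f g] by (fastforce simp: in_vars_def)

lemma in_vars_0: "in_vars n 0"
  by (simp add: in_vars_def)

lemma in_vars_sum: "(\<And>x. x \<in> A \<Longrightarrow> in_vars n (f x)) \<Longrightarrow> in_vars n (sum f A)"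
  by (induction A rule: infinite_finite_induct) (auto simp: in_vars_add in_vars_0)

lemma in_vars_mult:
  fixes f g :: "'k::comm_ring_1 mpoly"
  assumes "in_vars n f" "in_vars n g"
  shows "in_vars n (f * g)"
  using keys_mult[of f g] assms unfolding in_vars_def by (fastforce simp: keys_add_nat)

lemma in_vars_linform: "in_vars n (linform n c)"
  unfolding linform_def by (intro in_vars_sum) (auto simp: in_vars_def)

text \<open>Each monomial of an element of the right-hand side is divisible by some generator, and
  its quotient still involves only the variables 1..n; summing over the support gives the
  cofactors.\<close>

lemma mci_ideal_eq:
  "mci_ideal n e = (mono_ideal {1..n} e \<inter> {f. in_vars n f} :: 'k::comm_ring_1 mpoly set)"
proof (intro equalityI subsetI)
  fix f :: "'k mpoly" assume "f \<in> mci_ideal n e"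
  then obtain q where q: "\<forall>j\<in>{1..n}. in_vars n (q j)" "f = (\<Sum>j=1..n. q j * Var j ^ e j)"
    by (auto simp: mci_ideal_def)
  have "q j * Var j ^ e j \<in> mono_ideal {1..n} e" if "j \<in> {1..n}" for j
    using that by (intro is_idealD(3)[OF is_ideal_mono_ideal]) (auto simp: Var_power intro!: bexI[of _ j])
  moreover have "in_vars n (q j * Var j ^ e j)" if "j \<in> {1..n}" for j
    using that q(1) by (intro in_vars_mult) (auto simp: Var_power in_vars_def)
  ultimately show "f \<in> mono_ideal {1..n} e \<inter> {f. in_vars n f}"
    unfolding q(2) by (auto intro!: is_ideal_sum is_ideal_mono_ideal in_vars_sum)
next
  fix f :: "'k mpoly" assume f: "f \<in> mono_ideal {1..n} e \<inter> {f. in_vars n f}"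
  have add: "g + h \<in> mci_ideal n e" if "g \<in> mci_ideal n e" "h \<in> mci_ideal n e" for g h :: "'k mpoly"
  proof -
    from that obtain q r where
      "\<forall>j\<in>{1..n}. in_vars n (q j)" "g = (\<Sum>j=1..n. q j * Var j ^ e j)"
      "\<forall>j\<in>{1..n}. in_vars n (r j)" "h = (\<Sum>j=1..n. r j * Var j ^ e j)"
      by (auto simp: mci_ideal_def)
    then show ?thesis
      by (auto simp: mci_ideal_def sum.distrib algebra_simps in_vars_add intro!: exI[of _ "\<lambda>j. q j + r j"])
  qed
  have zero: "(0 :: 'k mpoly) \<in> mci_ideal n e"
    by (auto simp: mci_ideal_def in_vars_def intro!: exI[of _ "\<lambda>_. 0"])
  have mon: "single m (lookup f m) \<in> mci_ideal n e" if m: "m \<in> keys f" for m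
  proof -
    from m f obtain j where j: "j \<in> {1..n}" "e j \<le> lookup m j" by (auto simp: mono_ideal_def)
    \<comment> \<open>Divide the monomial by the j-th generator and let all other cofactors
      vanish.\<close>
    let ?q = "\<lambda>i. if i = j then single (m - single j (e j)) (lookup f m) else 0"
    have "keys (m - single j (e j)) \<subseteq> {1..n}"
      using m f keys_diff_nat[of m] by (auto simp: in_vars_def)
    moreover have "(\<Sum>i=1..n. ?q i * Var i ^ e i) = (\<Sum>i=1..n. if i = j then single m (lookup f m) else 0)"
      using single_add_diff[OF j(2)]
      by (intro sum.cong) (auto simp: Var_power mult_single add.commute)
    ultimately show ?thesis
      using j unfolding mci_ideal_def by (auto simp: in_vars_def split: if_splits intro!: exI[of _ ?q])
  qed
  have "(\<Sum>m\<in>A. single m (lookup f m)) \<in> mci_ideal n e" if "A \<subseteq> keys f" for A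
    using finite_subset[OF that finite_keys] that
    by (induction A rule: finite_induct) (auto simp: zero add mon)
  from this[of "keys f"] show "f \<in> mci_ideal n e" by (simp add: sum_single_keys)
qed

section \<open>Surjectivity and duality\<close>

text \<open>No degree or variable restriction is put on the cofactor of \<open>l\<close>: a homogeneous component
  of any witness is again a witness.\<close>

definition surj_at :: "nat \<Rightarrow> (nat \<Rightarrow> nat) \<Rightarrow> 'k::comm_ring_1 mpoly \<Rightarrow> nat \<Rightarrow> bool" where
  "surj_at n e l i \<longleftrightarrow> (\<forall>m. mon_in n (Suc i) m \<longrightarrow> monomial m \<in> lin_ideal {1..n} e l)"

lemma restr_mon_in_linform_mult:
  fixes f :: "'k::comm_ring_1 mpoly"
  shows "restr (mon_in n (Suc i)) (linform n c * f) = linform n c * restr (mon_in n i) f"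
  using mon_in_single_add[of _ n 1 i] by (intro restr_linform_mult) simp

lemma mult_surj_iff:
  fixes c :: "nat \<Rightarrow> 'k::comm_ring_1"
  shows "mult_surj n e (linform n c) i \<longleftrightarrow> surj_at n e (linform n c) i"
proof
  assume *: "mult_surj n e (linform n c) i"
  show "surj_at n e (linform n c) i"
    unfolding surj_at_def
  proof safe
    fix m assume "mon_in n (Suc i) m"
    then have "in_vars n (monomial m :: 'k mpoly) \<and> homog (i + 1) (monomial m :: 'k mpoly)"
      by (auto simp: mon_in_def in_vars_def homog_def)
    then show "monomial m \<in> lin_ideal {1..n} e (linform n c)"
      using * unfolding mult_surj_def mci_ideal_eq lin_ideal_def by blast
  qed
next
  assume *: "surj_at n e (linform n c) i"
  show "mult_surj n e (linform n c) i"
    unfolding mult_surj_def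
  proof safe
    fix g :: "'k mpoly" assume g: "in_vars n g" "homog (i + 1) g"
    then have k: "mon_in n (Suc i) m" if "m \<in> keys g" for m
      using that by (auto simp: mon_in_def in_vars_def homog_def)
    with * have "monomial m \<in> lin_ideal {1..n} e (linform n c)" if "m \<in> keys g" for m
      using that by (simp add: surj_at_def)
    then have "g \<in> lin_ideal {1..n} e (linform n c)"
      by (rule is_ideal_monomials[OF is_ideal_lin_ideal])
    then obtain f where f: "g - linform n c * f \<in> mono_ideal {1..n} e"
      by (auto simp: lin_ideal_def)
    define f' where "f' = restr (mon_in n i) f"
    have eq: "g - linform n c * f' = restr (mon_in n (Suc i)) (g - linform n c * f)"
      using k by (simp add: f'_def restr_diff restr_mon_in_linform_mult restr_id)
    have "g - linform n c * f' \<in> mci_ideal n e"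
      unfolding mci_ideal_eq eq using restr_mono_ideal[OF f]
      by (auto simp: in_vars_def keys_restr mon_in_def)
    moreover have "in_vars n f' \<and> homog i f'"
      by (auto simp: in_vars_def homog_def keys_restr f'_def mon_in_def)
    ultimately show "\<exists>f. in_vars n f \<and> homog i f \<and> g - linform n c * f \<in> mci_ideal n e"
      by blast
  qed
qed

lemma mult_inj_iff:
  fixes c :: "nat \<Rightarrow> 'k::comm_ring_1"
  shows "mult_inj n e (linform n c) i \<longleftrightarrow>
    (\<forall>f. (\<forall>m\<in>keys f. mon_in n i m) \<and> linform n c * f \<in> mono_ideal {1..n} e \<longrightarrow> f \<in> mono_ideal {1..n} e)"
proof -
  have "(\<forall>m\<in>keys f. mon_in n i m) \<longleftrightarrow> in_vars n f \<and> homog i f" for f :: "'k mpoly"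
    by (auto simp: mon_in_def in_vars_def homog_def)
  then show ?thesis
    unfolding mult_inj_def mci_ideal_eq using in_vars_mult[OF in_vars_linform[of n c]] by auto
qed

lemma mon_in_SucE:
  assumes "mon_in n (Suc i) m"
  obtains j m' where "j \<in> {1..n}" "m = single j 1 + m'" "mon_in n i m'"
proof -
  have "m \<noteq> 0" using assms by (auto simp: mon_in_def mon_deg_def)
  then obtain j where j: "j \<in> keys m" by (metis keys_eq_empty all_not_in_conv)
  with assms have "j \<in> {1..n}" by (auto simp: mon_in_def)
  moreover have "m = single j 1 + (m - single j 1)"
    using j by (subst single1_add_diff) (auto simp: in_keys_iff)
  ultimately show ?thesis
    using that assms mon_in_single_add[of j n 1 i "m - single j 1"] by simp
qed

lemma surj_at_Suc:
  assumes "surj_at n e l i"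
  shows "surj_at n e l (Suc i)"
  unfolding surj_at_def
proof safe
  fix m assume "mon_in n (Suc (Suc i)) m"
  then obtain j m' where m: "m = single j 1 + m'" "mon_in n (Suc i) m'"
    by (rule mon_in_SucE)
  then have "monomial (single j 1) * monomial m' \<in> lin_ideal {1..n} e l"
    using assms by (intro is_idealD(3)[OF is_ideal_lin_ideal]) (auto simp: surj_at_def)
  then show "monomial m \<in> lin_ideal {1..n} e l"
    by (simp add: mult_single m)
qed

lemma surj_at_mono: "i \<le> k \<Longrightarrow> surj_at n e l i \<Longrightarrow> surj_at n e l k"
  by (induction k rule: dec_induct) (auto intro: surj_at_Suc)

section \<open>The socle monomial and Gorenstein duality\<close>

definition top_mon :: "nat \<Rightarrow> (nat \<Rightarrow> nat) \<Rightarrow> (nat \<Rightarrow>\<^sub>0 nat)" where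
  "top_mon n e = (\<Sum>j=1..n. single j (e j - 1))"

definition socle_deg :: "nat \<Rightarrow> (nat \<Rightarrow> nat) \<Rightarrow> nat" where
  "socle_deg n e = (\<Sum>j=1..n. (e j - 1))"

lemma lookup_top_mon: "lookup (top_mon n e) j = (if j \<in> {1..n} then e j - 1 else 0)"
proof -
  have "lookup (top_mon n e) j = (\<Sum>i=1..n. if i = j then e j - 1 else 0)"
    unfolding top_mon_def lookup_sum by (intro sum.cong) (auto simp: lookup_single when_def)
  then show ?thesis by simp
qed

lemma mon_in_top_mon: "mon_in n (socle_deg n e) (top_mon n e)"
proof -
  have "keys (top_mon n e) \<subseteq> {1..n}"
    by (auto simp: in_keys_iff lookup_top_mon split: if_splits)
  then show ?thesis
    by (simp add: mon_in_def mon_deg_eq[of _ n] lookup_top_mon socle_deg_def)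
qed

text \<open>A monomial outside the ideal divides the socle monomial, so the truncated subtraction of
  exponents is a genuine complement.\<close>

lemma top_mon_diff_add:
  assumes "keys m \<subseteq> {1..n}" "\<not> (\<exists>j\<in>{1..n}. e j \<le> lookup m j)"
  shows "m + (top_mon n e - m) = top_mon n e"
proof (rule poly_mapping_eqI)
  fix j
  show "lookup (m + (top_mon n e - m)) j = lookup (top_mon n e) j"
  proof (cases "j \<in> {1..n}")
    case True
    with assms(2) have "lookup m j < e j" by (meson not_le)
    with True show ?thesis by (simp add: lookup_add lookup_minus lookup_top_mon)
  next
    case False
    with assms(1) have "lookup m j = 0" by (auto simp: in_keys_iff)
    with False show ?thesis by (auto simp: lookup_add lookup_minus lookup_top_mon)
  qed
qed

lemma mon_in_top_mon_diff:
  assumes "mon_in n i m" "\<not> (\<exists>j\<in>{1..n}. e j \<le> lookup m j)"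
  shows "i \<le> socle_deg n e" "mon_in n (socle_deg n e - i) (top_mon n e - m)"
proof -
  have m: "keys m \<subseteq> {1..n}" "mon_deg m = i" using assms(1) by (auto simp: mon_in_def)
  note eq = top_mon_diff_add[OF m(1) assms(2)]
  have *: "keys (top_mon n e) \<subseteq> {1..n}" "mon_deg (top_mon n e) = socle_deg n e"
    using mon_in_top_mon[of n e] by (simp_all add: mon_in_def)
  have d: "i + mon_deg (top_mon n e - m) = socle_deg n e"
    using mon_deg_add[of m "top_mon n e - m"] eq m(2) * by simp
  then show "i \<le> socle_deg n e" by linarith
  show "mon_in n (socle_deg n e - i) (top_mon n e - m)"
    unfolding mon_in_def using d keys_diff_nat[of "top_mon n e" m] * by auto
qed

lemma lookup_mono_ideal_top_mon:
  assumes "\<forall>j\<in>{1..n}. e j > 0" "f \<in> mono_ideal {1..n} e"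
  shows "lookup f (top_mon n e) = 0"
proof (rule ccontr)
  assume "lookup f (top_mon n e) \<noteq> 0"
  then obtain j where "j \<in> {1..n}" "e j \<le> lookup (top_mon n e) j"
    using assms(2) by (auto simp: mono_ideal_def in_keys_iff[symmetric])
  then show False using assms(1) by (fastforce simp: lookup_top_mon)
qed

lemma keys_linform_mult:
  fixes f :: "'k::comm_ring_1 mpoly"
  assumes "\<forall>m\<in>keys f. mon_in n i m"
  shows "\<forall>m\<in>keys (linform n c * f). mon_in n (Suc i) m"
proof -
  have "linform n c * f = restr (mon_in n (Suc i)) (linform n c * f)"
    using assms by (simp add: restr_mon_in_linform_mult restr_id)
  then show ?thesis by (metis (lifting) keys_restr mem_Collect_eq)
qed

text \<open>The quotient vanishes above the socle degree, so the target of the map is zero.\<close>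

lemma surj_at_ge:
  assumes "socle_deg n e \<le> i"
  shows "surj_at n e l i"
  unfolding surj_at_def
proof safe
  fix m assume "mon_in n (Suc i) m"
  then have "\<exists>j\<in>{1..n}. e j \<le> lookup m j"
    using mon_in_top_mon_diff(1)[of n "Suc i" m e] assms by force
  then show "monomial m \<in> lin_ideal {1..n} e l"
    by (intro mono_ideal_sub_lin_ideal) simp
qed

text \<open>If l f lies in the ideal but f has a monomial m outside it, surjectivity writes the
  complement t - m of m as a multiple of l modulo the ideal. Hence f times that complement lies in
  the ideal, yet its coefficient at the socle monomial t is the nonzero coefficient of f at
  m.\<close>

lemma surj_at_imp_mult_inj:
  fixes c :: "nat \<Rightarrow> 'k::comm_ring_1"
  assumes e: "\<forall>j\<in>{1..n}. e j > 0" and s: "surj_at n e (linform n c) (socle_deg n e - 1 - i)"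
    and i: "i < socle_deg n e"
  shows "mult_inj n e (linform n c) i"
  unfolding mult_inj_iff
proof safe
  fix f assume f: "\<forall>m\<in>keys f. mon_in n i m" "linform n c * f \<in> mono_ideal {1..n} e"
  let ?t = "top_mon n e"
  show "f \<in> mono_ideal {1..n} e"
    unfolding mono_ideal_def
  proof (intro CollectI ballI, rule ccontr)
    fix m assume m: "m \<in> keys f" "\<not> (\<exists>j\<in>{1..n}. e j \<le> lookup m j)"
    from m f have mi: "mon_in n i m" by auto
    have "mon_in n (Suc (socle_deg n e - 1 - i)) (?t - m)"
      using mon_in_top_mon_diff(2)[OF mi m(2)] i by (simp add: Suc_diff_Suc)
    then obtain h where h: "monomial (?t - m) - linform n c * h \<in> mono_ideal {1..n} e"
      using s by (auto simp: surj_at_def lin_ideal_def)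
    note I = is_idealD[OF is_ideal_mono_ideal[of "{1..n}" e, where 'k='k]]
    \<comment> \<open>The two products f l h cancel.\<close>
    have "f * (monomial (?t - m) - linform n c * h) + h * (linform n c * f) \<in> mono_ideal {1..n} e"
      by (rule I(2)[OF I(3)[OF h] I(3)[OF f(2)]])
    then have "monomial (?t - m) * f \<in> mono_ideal {1..n} e"
      by (simp add: algebra_simps)
    then have "lookup (monomial (?t - m) * f) (?t - m + m) = 0"
      using lookup_mono_ideal_top_mon[OF e] top_mon_diff_add[of m n e] mi m(2)
      by (simp add: add.commute mon_in_def)
    then show False using m(1) by (simp only: lookup_single_mult) (simp add: in_keys_iff)
  qed
qed

text \<open>The ideal is a subspace for the scalars \<open>single 0 c\<close>; a basis of it stays
  independent after adding g, so values on it can be prescribed.\<close>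

lemma exists_functional_vanishing_on_ideal:
  fixes I :: "'k::field mpoly set"
  assumes "is_ideal I" "g \<notin> I"
  obtains \<phi> :: "'k mpoly \<Rightarrow> 'k" where "\<And>f h. \<phi> (f + h) = \<phi> f + \<phi> h"
    "\<And>c f. \<phi> (single 0 c * f) = c * \<phi> f" "\<And>f. f \<in> I \<Longrightarrow> \<phi> f = 0" "\<phi> g = 1"
proof -
  let ?s = "\<lambda>c (f :: 'k mpoly). single 0 c * f"
  interpret vector_space_pair ?s "(*) :: 'k \<Rightarrow> 'k \<Rightarrow> 'k"
    by unfold_locales (simp_all add: distrib_left distrib_right single_add mult_single mult.assoc[symmetric])
  have sub: "vs1.subspace I"
    using is_idealD[OF assms(1)] by (auto simp: vs1.subspace_def)
  obtain B where B: "B \<subseteq> I" "vs1.independent B" "I \<subseteq> vs1.span B"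
    by (rule vs1.maximal_independent_subset)
  have "vs1.span B \<subseteq> I" by (rule vs1.span_minimal[OF B(1) sub])
  with assms(2) have "g \<notin> vs1.span B" by auto
  then have "vs1.independent (insert g B)" by (rule vs1.independent_insertI[OF _ B(2)])
  then obtain \<phi> where \<phi>: "Vector_Spaces.linear ?s (*) \<phi>" "\<forall>x\<in>insert g B. \<phi> x = (if x = g then 1 else 0)"
    using linear_independent_extend[of "insert g B" "\<lambda>x. if x = g then 1 else 0"] by blast
  interpret l: Vector_Spaces.linear ?s "(*)" \<phi> by (rule \<phi>(1))
  have "\<phi> x = 0" if "x \<in> B" for x using \<phi>(2) that B(1) assms(2) by auto
  then have "\<phi> f = 0" if "f \<in> I" for f
    using l.eq_0_on_span[of B f] that B(3) by blast
  moreover have "\<phi> g = 1" using \<phi>(2) by simp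
  ultimately show ?thesis by (intro that[of \<phi>]) (auto simp: l.add l.scale)
qed

lemma finite_mon_le: "finite {m. \<forall>j. lookup m j \<le> lookup (t :: nat \<Rightarrow>\<^sub>0 nat) j}" (is "finite ?M")
proof (rule finite_imageD)
  have b: "lookup t j \<le> mon_deg t" for j
    unfolding mon_deg_def by (cases "j \<in> keys t") (auto intro: member_le_sum simp: in_keys_iff)
  have "lookup ` ?M \<subseteq> {f. \<forall>x. (x \<in> keys t \<longrightarrow> f x \<in> {..mon_deg t}) \<and> (x \<notin> keys t \<longrightarrow> f x = 0)}"
    using b by (auto simp: in_keys_iff intro: order_trans)
      (metis bot_nat_0.extremum_uniqueI)
  then show "finite (lookup ` ?M)"
    by (rule finite_subset) (intro finite_set_of_finite_funs, auto)
  show "inj_on lookup ?M"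
    by (rule inj_onI) (rule poly_mapping_eqI, metis)
qed

text \<open>If surjectivity fails, some functional kills l and the ideal but not a monomial of the
  target degree. The socle pairing represents it by a polynomial F of degree i. Then l F pairs to
  zero with everything, so it lies in the ideal, and injectivity forces F = 0, a
  contradiction.\<close>

lemma mult_inj_imp_surj_at:
  fixes c :: "nat \<Rightarrow> 'k::field"
  assumes e: "\<forall>j\<in>{1..n}. e j > 0" and inj: "mult_inj n e (linform n c) i"
    and i: "i < socle_deg n e"
  shows "surj_at n e (linform n c) (socle_deg n e - 1 - i)"
proof (rule ccontr)
  let ?t = "top_mon n e" and ?l = "linform n c" and ?N = "socle_deg n e"
  let ?I = "mono_ideal {1..n} e :: 'k mpoly set" and ?W = "lin_ideal {1..n} e (linform n c)"
  assume "\<not> surj_at n e (linform n c) (?N - 1 - i)"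
  then obtain \<mu> where \<mu>: "mon_in n (?N - i) \<mu>" "monomial \<mu> \<notin> ?W"
    using i by (auto simp: surj_at_def Suc_diff_Suc)
  obtain \<phi> where \<phi>: "\<And>f h. \<phi> (f + h) = \<phi> f + \<phi> h" "\<And>c f. \<phi> (single 0 c * f) = c * \<phi> f"
    "\<And>f. f \<in> ?W \<Longrightarrow> \<phi> f = 0" "\<phi> (monomial \<mu>) = 1"
    using exists_functional_vanishing_on_ideal[OF is_ideal_lin_ideal \<mu>(2)] by blast
  have \<phi>0: "\<phi> 0 = 0" using \<phi>(2)[of 0 0] by simp
  have \<phi>_sum: "\<phi> (sum h A) = (\<Sum>x\<in>A. \<phi> (h x))" if "finite A" for h and A :: "(nat \<Rightarrow>\<^sub>0 nat) set"
    using that by (induction A rule: finite_induct) (auto simp: \<phi>(1) \<phi>0)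
  define M where "M = {m. mon_in n (?N - i) m \<and> \<not> (\<exists>j\<in>{1..n}. e j \<le> lookup m j)}"
  have eqM: "m + (?t - m) = ?t" if "m \<in> M" for m
    using that by (intro top_mon_diff_add) (auto simp: M_def mon_in_def)
  have "M \<subseteq> {m. \<forall>j. lookup m j \<le> lookup ?t j}"
  proof safe
    fix m j assume "m \<in> M"
    from eqM[OF this] show "lookup m j \<le> lookup ?t j" by (metis lookup_add le_add1)
  qed
  then have finM: "finite M" by (rule finite_subset) (rule finite_mon_le)
  \<comment> \<open>The coefficient of F at the complement of m is the value of the functional at m,
    so that the socle coefficient of F G is the functional of G.\<close>
  define F where "F = (\<Sum>m\<in>M. single (?t - m) (\<phi> (monomial m)))"
  have inM: "m = m'" if "m \<in> M" "m' \<in> M" "?t - m = ?t - m'" for m m'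
    using eqM[OF that(1)] eqM[OF that(2)] that(3) by (metis add_right_cancel)
  have F: "lookup F (?t - m) = \<phi> (monomial m)" if "m \<in> M" for m
  proof -
    have "lookup F (?t - m) = (\<Sum>m'\<in>M. if m' = m then \<phi> (monomial m) else 0)"
      unfolding F_def lookup_sum using inM that
      by (intro sum.cong) (auto simp: lookup_single when_def)
    then show ?thesis using that finM by simp
  qed
  have keysF: "\<exists>m\<in>M. k = ?t - m" if "k \<in> keys F" for k
  proof -
    from that keys_sum[of "\<lambda>m. single (?t - m) (\<phi> (monomial m))" M] obtain m where
      "m \<in> M" "k \<in> keys (single (?t - m) (\<phi> (monomial m)))"
      unfolding F_def by blast
    then show ?thesis by (auto split: if_splits)
  qed
  have F_in: "\<forall>m\<in>keys F. mon_in n i m"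
  proof
    fix k assume "k \<in> keys F"
    then obtain m where m: "m \<in> M" "k = ?t - m" using keysF by blast
    show "mon_in n i k"
      using mon_in_top_mon_diff(2)[of n "?N - i" m e] m i by (simp add: M_def)
  qed
  have pair_mon: "lookup (F * monomial m) ?t = \<phi> (monomial m)" if "mon_in n (?N - i) m" for m
  proof (cases "m \<in> M")
    case True
    then show ?thesis
      using lookup_single_mult[of m 1 F "?t - m"] eqM F by (simp add: mult.commute)
  next
    case False
    then have "monomial m \<in> ?I" using that by (auto simp: M_def)
    moreover from this have "F * monomial m \<in> ?I" by (rule is_idealD(3)[OF is_ideal_mono_ideal])
    ultimately show ?thesis
      using lookup_mono_ideal_top_mon[OF e] \<phi>(3) mono_ideal_sub_lin_ideal by metis
  qed
  have pair: "lookup (F * G) ?t = \<phi> G" if "\<forall>m\<in>keys G. mon_in n (?N - i) m" for G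
  proof -
    have "lookup (F * single m b) ?t = \<phi> (single m b)" if "mon_in n (?N - i) m" for m b
    proof -
      have "F * single m b = single 0 b * (F * monomial m)"
        by (subst single_mult_monomial) (simp only: ac_simps)
      then have "lookup (F * single m b) ?t = b * \<phi> (monomial m)"
        using lookup_single_mult[of 0 b "F * monomial m" ?t] pair_mon[OF that] by (simp only: add_0)
      also have "\<dots> = \<phi> (single m b)"
        by (subst (2) single_mult_monomial) (simp only: \<phi>(2))
      finally show ?thesis .
    qed
    then have "(\<Sum>m\<in>keys G. lookup (F * single m (lookup G m)) ?t) = (\<Sum>m\<in>keys G. \<phi> (single m (lookup G m)))"
      using that by (intro sum.cong) auto
    then have "lookup (F * (\<Sum>m\<in>keys G. single m (lookup G m))) ?t = \<phi> (\<Sum>m\<in>keys G. single m (lookup G m))"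
      by (simp add: sum_distrib_left lookup_sum \<phi>_sum)
    then show ?thesis by (simp only: sum_single_keys)
  qed
  \<comment> \<open>A monomial k of l F outside the ideal would be detected by its complement: the
    socle coefficient of F l x^(t - k) is the functional at a multiple of l, hence zero.\<close>
  have "?l * F \<in> ?I"
    unfolding mono_ideal_def
  proof (intro CollectI ballI, rule ccontr)
    fix k assume k: "k \<in> keys (?l * F)" "\<not> (\<exists>j\<in>{1..n}. e j \<le> lookup k j)"
    have ki: "mon_in n (Suc i) k" using keys_linform_mult[OF F_in] k(1) by blast
    have "\<forall>m\<in>keys (?l * monomial (?t - k)). mon_in n (Suc (?N - Suc i)) m"
      using mon_in_top_mon_diff(2)[OF ki k(2)] by (intro keys_linform_mult) simp
    then have "lookup (F * (?l * monomial (?t - k))) ?t = 0"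
      using i by (subst pair) (auto simp: Suc_diff_Suc \<phi>(3) mult_in_lin_ideal)
    moreover have "?t - k + k = ?t"
      using top_mon_diff_add[of k n e] ki k(2) by (simp add: mon_in_def add.commute)
    ultimately have "lookup (monomial (?t - k) * (?l * F)) (?t - k + k) = 0"
      by (simp add: ac_simps)
    then show False using k(1) by (simp only: lookup_single_mult) (simp add: in_keys_iff)
  qed
  then have FI: "F \<in> ?I" using inj F_in unfolding mult_inj_iff by blast
  \<comment> \<open>All monomials of F divide the socle monomial, so none of them lies in the
    ideal.\<close>
  have "keys F = {}"
  proof (rule ccontr)
    assume "keys F \<noteq> {}"
    then obtain k where k: "k \<in> keys F" by blast
    then obtain m where m: "k = ?t - m" using keysF by blast
    obtain j where j: "j \<in> {1..n}" "e j \<le> lookup k j" using FI k by (auto simp: mono_ideal_def)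
    have "e j > 0" using e j(1) by blast
    then show False using j m by (auto simp: lookup_minus lookup_top_mon)
  qed
  then have "F = 0" by simp
  moreover have "lookup (F * monomial \<mu>) ?t = 1" using pair_mon[OF \<mu>(1)] \<phi>(4) by simp
  ultimately show False by simp
qed

text \<open>With N the socle degree, injectivity at N div 2 dualizes to surjectivity at N - 1 - N
  div 2, which is at most N div 2. Conversely, for i below N div 2 the dual degree N - 1 - i is at
  least N div 2, so surjectivity there yields injectivity at i.\<close>

lemma WLP_iff_surj_at_middle:
  assumes e: "\<forall>j\<in>{1..n}. e j > 0"
  shows "WLP TYPE('k::field) n e \<longleftrightarrow>
    (\<exists>c :: nat \<Rightarrow> 'k. surj_at n e (linform n c) (socle_deg n e div 2))" (is "?L \<longleftrightarrow> ?R")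
proof
  let ?N = "socle_deg n e"
  assume ?L
  then obtain c :: "nat \<Rightarrow> 'k" where
    "mult_inj n e (linform n c) (?N div 2) \<or> mult_surj n e (linform n c) (?N div 2)"
    by (auto simp: WLP_def)
  then have "surj_at n e (linform n c) (?N div 2)"
  proof
    assume inj: "mult_inj n e (linform n c) (?N div 2)"
    show ?thesis
    \<comment> \<open>The inequality fails only for N = 0, where the target is zero.\<close>
    proof (cases "?N div 2 < ?N")
      case True
      from mult_inj_imp_surj_at[OF e inj this] show ?thesis
        by (rule surj_at_mono[rotated]) linarith
    next
      case False
      then show ?thesis by (intro surj_at_ge) simp
    qed
  qed (simp add: mult_surj_iff)
  then show ?R by blast
next
  let ?N = "socle_deg n e"
  assume ?R
  then obtain c :: "nat \<Rightarrow> 'k" where c: "surj_at n e (linform n c) (?N div 2)" by blast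
  have "mult_inj n e (linform n c) i \<or> mult_surj n e (linform n c) i" for i
  proof (cases "?N div 2 \<le> i")
    case True
    then show ?thesis using surj_at_mono[OF True c] by (simp add: mult_surj_iff)
  next
    case False
    then have "?N div 2 \<le> ?N - 1 - i" "i < ?N" by linarith+
    then show ?thesis using surj_at_imp_mult_inj[OF e surj_at_mono[OF _ c]] by blast
  qed
  then show ?L by (auto simp: WLP_def)
qed

section \<open>Making coefficients of the linear form nonzero\<close>

lemma linform_upd:
  assumes "j \<in> {1..n}" "c j = 0"
  shows "linform n (c(j := 1)) = linform n c + monomial (single j 1)"
proof -
  have "linform n (c(j := 1)) = monomial (single j 1) + (\<Sum>k\<in>{1..n} - {j}. single (single k 1) (c k))"
    unfolding linform_def using assms by (subst sum.remove[of _ j]) (auto intro!: sum.cong)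
  also have "(\<Sum>k\<in>{1..n} - {j}. single (single k 1) (c k)) = linform n c"
    unfolding linform_def using assms by (subst (2) sum.remove[of _ j]) auto
  finally show ?thesis by (simp only: add.commute)
qed

text \<open>Since l does not involve x_j, a witness for m can be cut down to a part rho of the same
  x_j-degree as m. With l' = l + x_j, m is l' rho - x_j rho modulo the ideal, and x_j rho has larger
  x_j-degree. The recursion stops once that degree reaches e j.\<close>

lemma surj_at_upd:
  fixes c :: "nat \<Rightarrow> 'k::comm_ring_1"
  assumes s: "surj_at n e (linform n c) i" and j: "j \<in> {1..n}" "c j = 0"
  shows "surj_at n e (linform n (c(j := 1))) i"
proof -
  let ?l = "linform n c" and ?l' = "linform n (c(j := 1))"
  let ?W = "lin_ideal {1..n} e ?l'"
  note I = is_idealD[OF is_ideal_lin_ideal[of "{1..n}" e ?l']]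
  have "monomial m \<in> ?W" if "mon_in n (Suc i) m" for m
    using that
  proof (induction "e j - lookup m j" arbitrary: m rule: less_induct)
    case less
    show ?case
    proof (cases "e j \<le> lookup m j")
      case True
      then show ?thesis using j(1) by (intro mono_ideal_sub_lin_ideal) auto
    next
      case False
      obtain f where f: "monomial m - ?l * f \<in> mono_ideal {1..n} e"
        using s less.prems by (auto simp: surj_at_def lin_ideal_def)
      define \<rho> where "\<rho> = restr (\<lambda>k. mon_in n i k \<and> lookup k j = lookup m j) f"
      have "restr (\<lambda>k. mon_in n (Suc i) k \<and> lookup k j = lookup m j) (?l * f) = ?l * \<rho>"
        unfolding \<rho>_def
      proof (rule restr_linform_mult)
        fix k m' assume "k \<in> {1..n}" "c k \<noteq> 0"
        moreover from this j(2) have "k \<noteq> j" by auto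
        ultimately show "(mon_in n (Suc i) (single k 1 + m') \<and> lookup (single k 1 + m') j = lookup m j)
            = (mon_in n i m' \<and> lookup m' j = lookup m j)"
          using mon_in_single_add[of k n 1 i m'] by (simp add: lookup_add lookup_single)
      qed
      then have "monomial m - ?l * \<rho> =
          restr (\<lambda>k. mon_in n (Suc i) k \<and> lookup k j = lookup m j) (monomial m - ?l * f)"
        using less.prems by (simp add: restr_diff restr_single)
      then have 1: "monomial m - ?l * \<rho> \<in> ?W"
        using restr_mono_ideal[OF f] by (auto intro: mono_ideal_sub_lin_ideal)
      have 2: "monomial (single j 1) * \<rho> \<in> ?W"
      proof (rule is_ideal_monomials[OF is_ideal_lin_ideal])
        fix k assume "k \<in> keys (monomial (single j 1) * \<rho>)"
        then obtain k' where k': "k = single j 1 + k'" "k' \<in> keys \<rho>"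
          using keys_single_mult by blast
        then have "mon_in n i k'" "lookup k' j = lookup m j"
          by (auto simp: \<rho>_def keys_restr)
        then have "mon_in n (Suc i) k" "lookup k j = Suc (lookup m j)"
          using k' mon_in_single_add[OF j(1), of 1 i k'] by (auto simp: lookup_add)
        then show "monomial k \<in> ?W"
          using False by (intro less.hyps) auto
      qed
      have "monomial m = (monomial m - ?l * \<rho>) - monomial (single j 1) * \<rho> + ?l' * \<rho>"
        unfolding linform_upd[OF j(1), of c, OF j(2)] by (simp add: algebra_simps)
      also have "\<dots> \<in> ?W"
        by (rule I(2)[OF I(6)[OF 1 2] mult_in_lin_ideal])
      finally show ?thesis .
    qed
  qed
  then show ?thesis by (simp add: surj_at_def)
qed

section \<open>Shifting the last two exponents\<close>

text \<open>A leading-term argument in x_n: among the monomials of f outside the ideal choose m of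
  largest x_n-degree. Then x_n m is still outside the ideal, because n is not in \<open>S\<close>,
  and it survives in the product.\<close>

lemma mono_ideal_linform_cancel:
  fixes c :: "nat \<Rightarrow> 'k::idom"
  assumes n: "n \<in> {1..N}" "c n \<noteq> 0" "n \<notin> S" and f: "linform N c * f \<in> mono_ideal S e"
  shows "f \<in> mono_ideal S e"
proof (rule ccontr)
  define B where "B = {m \<in> keys f. \<not> (\<exists>j\<in>S. e j \<le> lookup m j)}"
  assume "f \<notin> mono_ideal S e"
  then have "B \<noteq> {}" by (auto simp: B_def mono_ideal_def)
  moreover have "finite B" by (simp add: B_def)
  ultimately obtain m where m: "m \<in> B" "\<And>m'. m' \<in> B \<Longrightarrow> lookup m' n \<le> lookup m n"
    using Max_in[of "(\<lambda>m. lookup m n) ` B"] Max_ge[of "(\<lambda>m. lookup m n) ` B"]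
    by (smt (verit) finite_imageI image_iff image_is_empty)
  let ?\<mu> = "single n 1 + m"
  have good: "\<not> (\<exists>j\<in>S. e j \<le> lookup ?\<mu> j)"
    using m(1) n(3) by (auto simp: B_def lookup_add lookup_single when_def)
  have "(if 0 < lookup ?\<mu> j then c j * lookup f (?\<mu> - single j 1) else 0) =
        (if j = n then c n * lookup f m else 0)" if "j \<in> {1..N}" for j
  proof (cases "j = n")
    case True
    then show ?thesis by (simp add: lookup_add)
  next
    case False
    let ?k = "?\<mu> - single j 1"
    \<comment> \<open>Another contribution to x_n m would come from x_n m / x_j, which is outside
      the ideal and has x_n-degree one more than m, against maximality.\<close>
    have "?k \<notin> keys f" if "0 < lookup ?\<mu> j"
    proof
      assume "?k \<in> keys f"
      moreover have "lookup ?k i \<le> lookup ?\<mu> i" for i by (simp add: lookup_minus)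
      then have "\<not> (\<exists>i\<in>S. e i \<le> lookup ?k i)" using good le_trans by blast
      ultimately have "lookup ?k n \<le> lookup m n" by (intro m(2)) (simp add: B_def)
      then show False using False by (simp add: lookup_add lookup_minus lookup_single)
    qed
    then show ?thesis using False by (simp add: in_keys_iff)
  qed
  then have "lookup (linform N c * f) ?\<mu> = (\<Sum>j=1..N. if j = n then c n * lookup f m else 0)"
    unfolding lookup_linform_mult by (intro sum.cong) auto
  also have "\<dots> = c n * lookup f m"
    using n(1) by simp
  also have "\<dots> \<noteq> 0"
    using n(2) m(1) by (simp add: B_def in_keys_iff)
  finally have "?\<mu> \<in> keys (linform N c * f)" by (simp add: in_keys_iff)
  then show False using f good by (auto simp: mono_ideal_def)
qed

lemma mono_ideal_Var_power_cancel:
  assumes j: "j \<notin> S" and f: "monomial (single j k) * f \<in> mono_ideal S e"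
  shows "f \<in> mono_ideal S e"
  unfolding mono_ideal_def
proof safe
  fix m assume "m \<in> keys f"
  then have "single j k + m \<in> keys (monomial (single j k) * f)"
    by (simp add: in_keys_iff lookup_single_mult)
  then obtain i where "i \<in> S" "e i \<le> lookup (single j k + m) i"
    using f by (auto simp: mono_ideal_def)
  then show "\<exists>i\<in>S. e i \<le> lookup m i"
    using j by (intro bexI[of _ i]) (auto simp: lookup_add lookup_single when_def split: if_splits)
qed

text \<open>Splits off the j-th generator: here the element playing the role of l in
  \<open>lin_ideal\<close> is a pure power, not a linear form.\<close>

lemma mono_ideal_insert_sub_lin_ideal:
  fixes f :: "'k::comm_ring_1 mpoly"
  assumes "f \<in> mono_ideal (insert j S) e"
  shows "f \<in> lin_ideal S e (monomial (single j (e j)))"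
proof (rule is_ideal_monomials[OF is_ideal_lin_ideal])
  fix m assume "m \<in> keys f"
  then consider "\<exists>i\<in>S. e i \<le> lookup m i" | "e j \<le> lookup m j"
    using assms by (auto simp: mono_ideal_def)
  then show "(monomial m :: 'k mpoly) \<in> lin_ideal S e (monomial (single j (e j)))"
  proof cases
    case 1
    then show ?thesis by (intro mono_ideal_sub_lin_ideal) simp
  next
    case 2
    have "monomial m = monomial (single j (e j)) * (monomial (m - single j (e j)) :: 'k mpoly)"
      using single_add_diff[OF 2] by (simp add: mult_single)
    then show ?thesis by (simp only: mult_in_lin_ideal)
  qed
qed

lemma mono_ideal_subset:
  assumes "f \<in> mono_ideal S e" "S \<subseteq> T" "\<And>j. j \<in> S \<Longrightarrow> e' j \<le> e j"
  shows "f \<in> mono_ideal T e'"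
  using assms unfolding mono_ideal_def by (fastforce intro: order_trans)

lemma lin_ideal_subset:
  assumes "f \<in> lin_ideal S e l" "S \<subseteq> T" "\<And>j. j \<in> S \<Longrightarrow> e' j \<le> e j"
  shows "f \<in> lin_ideal T e' l"
  using assms mono_ideal_subset[of _ S e T e'] unfolding lin_ideal_def by blast

section \<open>Frobenius powers of linear forms\<close>

lemma CHAR_mpoly: "CHAR('k::comm_ring_1 mpoly) = CHAR('k)"
proof (rule CHAR_eqI)
  show "of_nat CHAR('k) = (0 :: 'k mpoly)"
    by (simp flip: single_of_nat)
  fix x assume "of_nat x = (0 :: 'k mpoly)"
  then have "lookup (of_nat x :: 'k mpoly) 0 = 0" by simp
  then show "CHAR('k) dvd x"
    by (simp add: lookup_of_nat of_nat_eq_0_iff_char_dvd)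
qed

lemma single_Var_power: "single (single j 1) c ^ k = single (single j k) (c ^ k :: 'k::comm_ring_1)"
  by (induction k) (auto simp: mult_single single_add[symmetric])

lemma linform_frobenius:
  fixes c :: "nat \<Rightarrow> 'k::field"
  assumes "CHAR('k) = p" "p > 0"
  shows "linform n c ^ (p ^ a) = (\<Sum>j=1..n. single (single j (p ^ a)) (c j ^ (p ^ a)))"
proof -
  have "prime CHAR('k mpoly)"
    unfolding CHAR_mpoly using assms by (intro prime_CHAR_semidom) simp
  then have "linform n c ^ (p ^ a) = (\<Sum>j=1..n. single (single j 1) (c j) ^ (p ^ a))"
    unfolding linform_def using assms(1) by (intro freshmans_dream_sum') (auto simp: CHAR_mpoly)
  then show ?thesis by (simp only: single_Var_power)
qed

text \<open>The exponents \<open>d\<close> belong to A and \<open>d'\<close> to B_b. They agree on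
  the first n - 2 variables, so \<open>L\<close>, generated by l and those relations, is contained
  in the ideals of both algebras modulo l.\<close>

locale two_variable_shift =
  fixes n a p b :: nat and d d' :: "nat \<Rightarrow> nat" and c :: "nat \<Rightarrow> 'k::field"
  assumes char: "CHAR('k) = p" "p > 0" and n2: "n \<ge> 2"
    and small: "\<forall>i\<in>{1..n-2}. d i \<le> p ^ a"
    and c_nz: "c (n - 1) \<noteq> 0" "c n \<noteq> 0"
    and d'_def: "d' = (\<lambda>j. if j = n - 1 \<or> j = n then d j + b * p ^ a else d j)"
begin

abbreviation "l \<equiv> linform n c"
abbreviation "r \<equiv> b * p ^ a"
abbreviation "X \<equiv> monomial (single (n - 1) r) :: 'k mpoly"
abbreviation "Y \<equiv> monomial (single n r) :: 'k mpoly"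
abbreviation "J \<equiv> mono_ideal {1..n-2} d :: 'k mpoly set"
abbreviation "L \<equiv> lin_ideal {1..n-2} d l"

lemma vars_eq: "{1..n} = insert n (insert (n - 1) {1..n-2})"
  using n2 by auto

lemma sum_vars: "(\<Sum>j=1..n. g j) = g n + g (n - 1) + (\<Sum>j=1..n-2. g j :: 'b::comm_monoid_add)"
proof -
  have "n \<notin> insert (n - 1) {1..n-2}" "n - 1 \<notin> {1..n-2}" using n2 by auto
  then show ?thesis unfolding vars_eq by (simp add: add.assoc)
qed

text \<open>Raising \<open>l\<close> to the power \<open>p ^ a\<close> kills the first \<open>n - 2\<close> variables modulo \<open>J\<close>,
  so \<open>y ^ (p ^ a)\<close> is a scalar multiple of \<open>x ^ (p ^ a)\<close> modulo \<open>l\<close> and \<open>J\<close>.\<close>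

lemma power_relation:
  obtains \<kappa> where "\<kappa> \<noteq> 0" "Y - single 0 \<kappa> * X \<in> L"
proof -
  let ?q = "p ^ a"
  note I = is_idealD[OF is_ideal_lin_ideal[of "{1..n-2}" d l]]
  let ?u = "monomial (single (n - 1) ?q) :: 'k mpoly" and ?v = "monomial (single n ?q) :: 'k mpoly"
  have "?q > 0" using char by simp
  then have "l ^ ?q = l * l ^ (?q - 1)" by (cases ?q) auto
  then have 1: "l ^ ?q \<in> L" by (simp add: mult_in_lin_ideal)
  \<comment> \<open>The bound d_i <= p^a enters here: these powers are already relations.\<close>
  have 2: "(\<Sum>j=1..n-2. single (single j ?q) (c j ^ ?q)) \<in> L"
  proof (intro mono_ideal_sub_lin_ideal is_ideal_sum[OF is_ideal_mono_ideal])
    fix j assume "j \<in> {1..n-2}"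
    then have "(monomial (single j ?q) :: 'k mpoly) \<in> J"
      using small by (auto intro!: bexI[of _ j])
    then show "single (single j ?q) (c j ^ ?q) \<in> J"
      by (subst single_mult_monomial) (rule is_idealD(3)[OF is_ideal_mono_ideal])
  qed
  \<comment> \<open>The scalar that solves c_n^q y^q + c_(n-1)^q x^q = 0 for y^q, where q =
    p^a.\<close>
  define \<kappa> where "\<kappa> = - (c (n - 1) ^ ?q / c n ^ ?q)"
  have "single (single n ?q) (c n ^ ?q) + single (single (n - 1) ?q) (c (n - 1) ^ ?q) \<in> L"
    using I(6)[OF 1 2] unfolding linform_frobenius[OF char] sum_vars by simp
  then have "single 0 (1 / c n ^ ?q) *
      (single (single n ?q) (c n ^ ?q) + single (single (n - 1) ?q) (c (n - 1) ^ ?q)) \<in> L"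
    by (rule I(3))
  moreover have "single 0 (1 / c n ^ ?q) *
      (single (single n ?q) (c n ^ ?q) + single (single (n - 1) ?q) (c (n - 1) ^ ?q)) = ?v - single 0 \<kappa> * ?u"
    using c_nz by (simp add: distrib_left mult_single \<kappa>_def single_uminus)
  ultimately have base: "?v - single 0 \<kappa> * ?u \<in> L" by simp
  \<comment> \<open>Congruent elements have congruent powers; the exponent k = b then gives
    \<open>Y\<close> and \<open>X\<close>.\<close>
  have "?v ^ k - (single 0 \<kappa> * ?u) ^ k \<in> L" for k
  proof (induction k)
    case 0
    then show ?case using I(1) by simp
  next
    case (Suc k)
    have "?v ^ Suc k - (single 0 \<kappa> * ?u) ^ Suc k =
        ?v * (?v ^ k - (single 0 \<kappa> * ?u) ^ k) + (single 0 \<kappa> * ?u) ^ k * (?v - single 0 \<kappa> * ?u)"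
      by (simp add: algebra_simps)
    then show ?case using I(2)[OF I(3)[OF Suc] I(3)[OF base]] by simp
  qed
  moreover have "monomial (single j ?q) ^ b = (monomial (single j r) :: 'k mpoly)" for j
    by (simp only: Var_power[symmetric] power_mult[symmetric] mult.commute)
  moreover have "single 0 \<kappa> ^ b = (single 0 (\<kappa> ^ b) :: 'k mpoly)"
    by (induction b) (simp_all add: mult_single)
  ultimately have "Y - single 0 (\<kappa> ^ b) * X \<in> L"
    by (metis power_mult_distrib)
  moreover have "\<kappa> ^ b \<noteq> 0" using c_nz by (simp add: \<kappa>_def)
  ultimately show ?thesis by (rule that[rotated])
qed

lemma L_sub: "f \<in> L \<Longrightarrow> f \<in> lin_ideal {1..n} d' l"
  by (rule lin_ideal_subset) (auto simp: d'_def)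

text \<open>The factor \<open>X\<close> raises a power of x to the exponent required in B_b. For a
  power of y the relation between \<open>Y\<close> and \<open>X\<close> is used: \<open>X\<close> is
  a nonzero scalar times \<open>Y\<close> modulo \<open>L\<close>.\<close>

lemma X_mult_mono_ideal:
  fixes f :: "'k mpoly"
  assumes "f \<in> mono_ideal {1..n} d"
  shows "X * f \<in> lin_ideal {1..n} d' l"
proof -
  obtain \<kappa> where \<kappa>: "\<kappa> \<noteq> 0" "Y - single 0 \<kappa> * X \<in> L" by (rule power_relation)
  let ?W = "lin_ideal {1..n} d' l"
  note I = is_idealD[OF is_ideal_lin_ideal[of "{1..n}" d' l]]
  have "is_ideal {f. X * f \<in> ?W}"
    unfolding is_ideal_def using I(1,2,3) by (auto simp: distrib_left mult.left_commute)
  then have "f \<in> {f. X * f \<in> ?W}"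
  proof (rule is_ideal_monomials)
    fix m assume "m \<in> keys f"
    then obtain j where j: "j \<in> {1..n}" "d j \<le> lookup m j"
      using assms by (auto simp: mono_ideal_def)
    then consider "j \<in> {1..n-2}" | "j = n - 1" | "j = n" unfolding vars_eq by blast
    then have "X * monomial m \<in> ?W"
    proof cases
      case 1
      then have "monomial m \<in> ?W"
        using j by (intro L_sub mono_ideal_sub_lin_ideal) auto
      then show ?thesis by (rule I(3))
    next
      case 2
      then have "d' j \<le> lookup (single (n - 1) r + m) j"
        using j(2) by (simp add: d'_def lookup_add)
      then show ?thesis using j(1) by (intro mono_ideal_sub_lin_ideal) (auto simp: mult_single)
    next
      case 3
      then have "d' j \<le> lookup (single n r + m) j"
        using j(2) by (simp add: d'_def lookup_add)
      then have "monomial m * Y \<in> ?W"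
        using j(1) by (intro mono_ideal_sub_lin_ideal) (auto simp: mult_single add.commute)
      then have "monomial m * Y - monomial m * (Y - single 0 \<kappa> * X) \<in> ?W"
        by (intro I(6) I(3)[OF L_sub[OF \<kappa>(2)]])
      then have "single 0 (1 / \<kappa>) * (monomial m * Y - monomial m * (Y - single 0 \<kappa> * X)) \<in> ?W"
        by (rule I(3))
      moreover have "single 0 (1 / \<kappa>) * (monomial m * Y - monomial m * (Y - single 0 \<kappa> * X)) =
          (single 0 (1 / \<kappa>) * single 0 \<kappa>) * (X * monomial m)"
        by (simp only: algebra_simps)
      ultimately show ?thesis using \<kappa>(1) by (simp add: mult_single)
    qed
    then show "monomial m \<in> {f. X * f \<in> ?W}" by simp
  qed
  then show ?thesis by simp
qed

text \<open>Induction on the exponent of y. As the coefficient of y in l is nonzero, one factor y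
  can be traded for the other variables modulo l. A monomial without y that avoids the first n - 2
  relations is \<open>X\<close> times a monomial of degree m + 1, to which surjectivity for A
  applies.\<close>

lemma surj_at_shift:
  assumes s: "surj_at n d l m" and m: "(\<Sum>i=1..n-2. (d i - 1)) \<le> Suc m"
  shows "surj_at n d' l (m + r)"
proof -
  let ?W = "lin_ideal {1..n} d' l"
  note I = is_idealD[OF is_ideal_lin_ideal[of "{1..n}" d' l]]
  have n: "n \<in> {1..n}" "n - 1 \<in> {1..n}" using n2 by auto
  have "monomial \<mu> \<in> ?W" if "mon_in n (r + Suc m) \<mu>" for \<mu>
    using that
  proof (induction "lookup \<mu> n" arbitrary: \<mu>)
    case 0
    show ?case
    proof (cases "\<exists>j\<in>{1..n-2}. d j \<le> lookup \<mu> j")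
      case True
      then show ?thesis by (intro L_sub mono_ideal_sub_lin_ideal) simp
    next
      case False
      have "(\<Sum>j=1..n-2. lookup \<mu> j) \<le> (\<Sum>i=1..n-2. (d i - 1))"
        using False by (intro sum_mono) (metis Suc_pred' leI less_Suc_eq_le not_less_zero neq0_conv)
      moreover have "(\<Sum>j=1..n. lookup \<mu> j) = r + Suc m"
        using 0(2) mon_deg_eq[of \<mu> n] by (simp add: mon_in_def)
      \<comment> \<open>The total degree is r + m + 1 and the first n - 2 variables account for at
        most m + 1 of it.\<close>
      ultimately have x: "r \<le> lookup \<mu> (n - 1)"
        using 0(1) m unfolding sum_vars by linarith
      define \<nu> where "\<nu> = \<mu> - single (n - 1) r"
      have \<mu>: "\<mu> = single (n - 1) r + \<nu>" using single_add_diff[OF x] by (simp add: \<nu>_def)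
      then have "mon_in n (Suc m) \<nu>" using 0(2) mon_in_single_add[OF n(2), of r "Suc m" \<nu>] by simp
      then obtain f where "monomial \<nu> - l * f \<in> mono_ideal {1..n} d"
        using s by (auto simp: surj_at_def lin_ideal_def)
      then have "X * (monomial \<nu> - l * f) + l * (X * f) \<in> ?W"
        by (intro I(2) X_mult_mono_ideal mult_in_lin_ideal)
      then show ?thesis by (simp add: \<mu> algebra_simps mult_single)
    qed
  next
    case (Suc k)
    define \<nu> where "\<nu> = \<mu> - single n 1"
    have \<mu>: "\<mu> = single n 1 + \<nu>" using Suc(2) single1_add_diff[of \<mu> n] by (simp add: \<nu>_def)
    have \<nu>: "mon_in n (r + m) \<nu>" "lookup \<nu> n = k"
      using Suc(2,3) mon_in_single_add[OF n(1), of 1 "r + m" \<nu>] unfolding \<mu> by (auto simp: lookup_add)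
    \<comment> \<open>In l nu every term except the one for y has y-exponent k, so the induction
      hypothesis covers it.\<close>
    have rest: "(\<Sum>j\<in>{1..n} - {n}. single (single j 1) (c j) * monomial \<nu>) \<in> ?W"
    proof (rule is_ideal_sum[OF is_ideal_lin_ideal])
      fix j assume j: "j \<in> {1..n} - {n}"
      have "mon_in n (r + Suc m) (single j 1 + \<nu>)"
        using mon_in_single_add[of j n 1 "r + m" \<nu>] j \<nu>(1) by simp
      moreover have "k = lookup (single j 1 + \<nu>) n"
        using j \<nu>(2) by (simp add: lookup_add lookup_single)
      ultimately have "single 0 (c j) * monomial (single j 1 + \<nu>) \<in> ?W"
        by (intro I(3) Suc(1))
      then show "single (single j 1) (c j) * monomial \<nu> \<in> ?W"
        by (simp add: mult_single)
    qed
    have l_eq: "l * monomial \<nu> = single 0 (c n) * monomial \<mu> +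
        (\<Sum>j\<in>{1..n} - {n}. single (single j 1) (c j) * monomial \<nu>)"
      unfolding linform_def \<mu> using n(1)
      by (subst sum.remove[of _ n]) (auto simp: distrib_right sum_distrib_right mult_single)
    have "single 0 (c n) * monomial \<mu> \<in> ?W"
      using I(6)[OF mult_in_lin_ideal[of l "monomial \<nu>"] rest] unfolding l_eq by simp
    then have "single 0 (1 / c n) * (single 0 (c n) * monomial \<mu>) \<in> ?W" by (rule I(3))
    then show ?case using c_nz by (simp add: mult_single mult.assoc[symmetric])
  qed
  then show ?thesis by (simp add: surj_at_def add.commute)
qed

text \<open>The first n - 2 relations vanish modulo \<open>L\<close>; the shifted power of x
  contains \<open>X\<close>; the shifted power of y contains \<open>Y\<close>, which becomes a
  scalar times \<open>X\<close>.\<close>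

lemma mono_ideal_shift_mod_L:
  fixes f :: "'k mpoly"
  assumes "f \<in> mono_ideal {1..n} d'"
  shows "\<exists>g\<in>mono_ideal {1..n} d. f - X * g \<in> L"
proof -
  obtain \<kappa> where \<kappa>: "\<kappa> \<noteq> 0" "Y - single 0 \<kappa> * X \<in> L" by (rule power_relation)
  let ?I = "mono_ideal {1..n} d :: 'k mpoly set"
  let ?V = "{f. \<exists>g\<in>?I. f - X * g \<in> L}"
  note I = is_idealD[OF is_ideal_lin_ideal[of "{1..n-2}" d l]]
  note M = is_idealD[OF is_ideal_mono_ideal[of "{1..n}" d, where 'k='k]]
  have "is_ideal ?V"
    unfolding is_ideal_def
  proof (intro conjI ballI allI)
    show "0 \<in> ?V" using I(1) M(1) by force
  next
    fix f h assume "f \<in> ?V" "h \<in> ?V"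
    then obtain g g' where g: "g \<in> ?I" "f - X * g \<in> L" "g' \<in> ?I" "h - X * g' \<in> L" by blast
    have "f + h - X * (g + g') \<in> L" using I(2)[OF g(2,4)] by (simp add: algebra_simps)
    then show "f + h \<in> ?V" using M(2)[OF g(1,3)] by blast
  next
    fix f h assume "f \<in> ?V"
    then obtain g where g: "g \<in> ?I" "f - X * g \<in> L" by blast
    have "h * f - X * (h * g) \<in> L" using I(3)[OF g(2), of h] by (simp add: algebra_simps)
    then show "h * f \<in> ?V" using M(3)[OF g(1)] by blast
  qed
  then have "f \<in> ?V"
  proof (rule is_ideal_monomials)
    fix m assume "m \<in> keys f"
    then obtain j where j: "j \<in> {1..n}" "d' j \<le> lookup m j"
      using assms by (auto simp: mono_ideal_def)
    then consider "j \<in> {1..n-2}" | "j = n - 1" | "j = n" unfolding vars_eq by blast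
    then show "monomial m \<in> ?V"
    proof cases
      case 1
      then have "d' j = d j" using n2 by (auto simp: d'_def)
      then have "monomial m - X * 0 \<in> L"
        using j(2) 1 mono_ideal_sub_lin_ideal[of "monomial m" "{1..n-2}" d l]
        by (auto simp del: atLeastAtMost_iff)
      then show ?thesis using M(1) by blast
    next
      case 2
      then have le: "d j + r \<le> lookup m j" using j(2) by (simp add: d'_def)
      then have m: "single j r + (m - single j r) = m" by (intro single_add_diff) simp
      have "monomial (m - single j r) \<in> ?I"
        using le j(1) by (auto simp: lookup_minus intro!: bexI[of _ j])
      moreover have "monomial m - X * monomial (m - single j r) \<in> L"
        using m 2 I(1) by (simp add: mult_single)
      ultimately show ?thesis by blast
    next
      case 3
      then have le: "d j + r \<le> lookup m j" using j(2) by (simp add: d'_def)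
      then have m: "single j r + (m - single j r) = m" by (intro single_add_diff) simp
      have "single 0 \<kappa> * monomial (m - single j r) \<in> ?I"
        using le j(1) by (intro M(3)) (auto simp: lookup_minus intro!: bexI[of _ j])
      moreover have "monomial m - X * (single 0 \<kappa> * monomial (m - single j r)) =
          monomial (m - single j r) * (Y - single 0 \<kappa> * X)"
      proof -
        have "monomial m = Y * (monomial (m - single j r) :: 'k mpoly)"
          using m 3 by (simp add: mult_single)
        then show ?thesis by (simp only: algebra_simps)
      qed
      ultimately show ?thesis using I(3)[OF \<kappa>(2)] by force
    qed
  qed
  then show ?thesis by blast
qed

text \<open>If X f - l h is in \<open>J\<close>, then l h lies in the monomial ideal generated by
  \<open>J\<close> and \<open>X\<close>, modulo which l is a nonzerodivisor because of its y-term.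
  So h is X h' modulo \<open>J\<close>, and X (f - l h') is in \<open>J\<close>, where
  \<open>X\<close> cancels.\<close>

lemma X_cancel_mod_L:
  fixes f :: "'k mpoly"
  assumes "X * f \<in> L"
  shows "f \<in> L"
proof -
  obtain h where h: "X * f - l * h \<in> J" using assms by (auto simp: lin_ideal_def)
  \<comment> \<open>Replacing the exponent of x by r presents the sum of \<open>J\<close> and the
    ideal of \<open>X\<close> as a \<open>mono_ideal\<close>.\<close>
  define e where "e = d(n - 1 := r)"
  let ?S = "insert (n - 1) {1..n-2}"
  have ed: "mono_ideal {1..n-2} e = J"
  proof -
    have "e j = d j" if "j \<in> {1..n-2}" for j using that n2 by (auto simp: e_def)
    then show ?thesis by (simp add: mono_ideal_def)
  qed
  note M = is_idealD[OF is_ideal_mono_ideal[of ?S e, where 'k='k]]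
  have "X \<in> mono_ideal ?S e" by (auto simp: e_def)
  moreover have "X * f - l * h \<in> mono_ideal ?S e"
    using h unfolding ed[symmetric] by (rule mono_ideal_subset) auto
  ultimately have "X * f - (X * f - l * h) \<in> mono_ideal ?S e"
    using M(4,6) by blast
  then have "l * h \<in> mono_ideal ?S e" by simp
  then have "h \<in> mono_ideal ?S e"
    using n2 c_nz by (intro mono_ideal_linform_cancel[of n n c ?S h e]) auto
  then have "h \<in> lin_ideal {1..n-2} e (monomial (single (n - 1) (e (n - 1))))"
    by (rule mono_ideal_insert_sub_lin_ideal)
  then obtain h' where h': "h - X * h' \<in> J"
    unfolding lin_ideal_def ed by (auto simp: e_def)
  note J = is_idealD[OF is_ideal_mono_ideal[of "{1..n-2}" d, where 'k='k]]
  have "(X * f - l * h) + l * (h - X * h') \<in> J" by (rule J(2)[OF h J(3)[OF h']])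
  then have XJ: "X * (f - l * h') \<in> J" by (simp add: algebra_simps)
  have "n - 1 \<notin> {1..n-2}" using n2 by auto
  from mono_ideal_Var_power_cancel[OF this XJ] have "f - l * h' \<in> J" .
  then show ?thesis by (auto simp: lin_ideal_def)
qed

text \<open>Multiply the target monomial by \<open>X\<close>, solve in B_b, rewrite the error term
  as \<open>X\<close> times an element of the ideal of A modulo \<open>L\<close>, and cancel
  \<open>X\<close>.\<close>

lemma surj_at_unshift:
  assumes s: "surj_at n d' l (m + r)"
  shows "surj_at n d l m"
  unfolding surj_at_def
proof safe
  fix \<mu> assume "mon_in n (Suc m) \<mu>"
  then have "mon_in n (Suc (m + r)) (single (n - 1) r + \<mu>)"
    using n2 mon_in_single_add[of "n - 1" n r "Suc m" \<mu>] by (simp add: add.commute)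
  then have "X * monomial \<mu> \<in> lin_ideal {1..n} d' l"
    using s by (simp add: surj_at_def mult_single)
  then obtain h where "X * monomial \<mu> - l * h \<in> mono_ideal {1..n} d'"
    by (auto simp: lin_ideal_def)
  then obtain g where g: "g \<in> mono_ideal {1..n} d" "X * monomial \<mu> - l * h - X * g \<in> L"
    using mono_ideal_shift_mod_L by blast
  have "(X * monomial \<mu> - l * h - X * g) + l * h \<in> L"
    by (rule is_idealD(2)[OF is_ideal_lin_ideal g(2) mult_in_lin_ideal])
  then have "X * (monomial \<mu> - g) \<in> L" by (simp add: algebra_simps)
  then have "monomial \<mu> - g \<in> L" by (rule X_cancel_mod_L)
  then have "monomial \<mu> - g \<in> lin_ideal {1..n} d l" by (rule lin_ideal_subset) auto
  then have "(monomial \<mu> - g) + g \<in> lin_ideal {1..n} d l"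
    by (rule is_idealD(2)[OF is_ideal_lin_ideal _ mono_ideal_sub_lin_ideal[OF g(1)]])
  then show "monomial \<mu> \<in> lin_ideal {1..n} d l" by simp
qed

end

section \<open>Assembling both directions\<close>

lemma surj_at_obtain_nonzero:
  fixes c :: "nat \<Rightarrow> 'k::field"
  assumes "surj_at n e (linform n c) i" "j \<in> {1..n}" "k \<in> {1..n}"
  obtains c' :: "nat \<Rightarrow> 'k" where "surj_at n e (linform n c') i" "c' j \<noteq> 0" "c' k \<noteq> 0"
proof -
  obtain c1 :: "nat \<Rightarrow> 'k" where c1: "surj_at n e (linform n c1) i" "c1 j \<noteq> 0"
    using assms surj_at_upd[OF assms(1,2)] by (cases "c j = 0") (auto intro: that)
  \<comment> \<open>A change at k happens only if \<open>c1 k = 0\<close>, so k differs from j and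
    \<open>c1 j\<close> stays nonzero.\<close>
  obtain c2 :: "nat \<Rightarrow> 'k" where "surj_at n e (linform n c2) i" "c2 j \<noteq> 0" "c2 k \<noteq> 0"
    using c1 surj_at_upd[OF c1(1) assms(3)] by (cases "c1 k = 0") (auto intro: that)
  then show ?thesis by (rule that)
qed

theorem theorem4p8:
  fixes d :: "nat \<Rightarrow> nat" and n a p :: nat
  assumes "CHAR('k::field) = p" and "p > 0"
    and "n \<ge> 2"
    and "\<forall>i\<in>{1..n}. d i > 0" and "a > 0"
    and "\<forall>i\<in>{1..n-2}. d i \<le> p ^ a"
  shows "(\<forall>b::nat. b > 0 \<longrightarrow>
            WLP TYPE('k) n (\<lambda>j. if j = n - 1 \<or> j = n then d j + b * p ^ a else d j)
            \<longrightarrow> WLP TYPE('k) n d)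
       \<and> ((\<Sum>i=1..n-2. (d i - 1)) \<le> d (n - 1) + d n \<longrightarrow>
            (\<forall>b::nat. b > 0 \<longrightarrow>
              (WLP TYPE('k) n d \<longleftrightarrow>
               WLP TYPE('k) n (\<lambda>j. if j = n - 1 \<or> j = n then d j + b * p ^ a else d j))))"
proof -
  let ?d' = "\<lambda>b j. if j = n - 1 \<or> j = n then d j + b * p ^ a else d j"
  have vars: "n - 1 \<in> {1..n}" "n \<in> {1..n}" using assms(3) by auto
  have shift: "two_variable_shift n a p b d (?d' b) c" if "c (n - 1) \<noteq> 0" "c n \<noteq> 0"
    for b and c :: "nat \<Rightarrow> 'k"
    using assms that by (auto simp: two_variable_shift_def)
  have d'_pos: "\<forall>i\<in>{1..n}. ?d' b i > 0" for b using assms(4) by auto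
  note iff = WLP_iff_surj_at_middle[OF assms(4), where 'k='k]
  note iff' = WLP_iff_surj_at_middle[OF d'_pos, where 'k='k]
  have split: "{1..n} = insert n (insert (n - 1) {1..n-2})" "n \<notin> insert (n - 1) {1..n-2}"
    "n - 1 \<notin> {1..n-2}" using assms(3) by auto
  have pos: "d n > 0" "d (n - 1) > 0" using assms(4) vars by blast+
  have deg: "socle_deg n d = (d n - 1) + (d (n - 1) - 1) + (\<Sum>i=1..n-2. (d i - 1))"
    unfolding socle_deg_def split(1) using split(2,3) by simp
  \<comment> \<open>Two exponents grow by b p^a each; positivity of d_(n-1) and d_n keeps the
    truncated subtractions exact. The even increment moves the middle by exactly b p^a.\<close>
  have deg': "socle_deg n (?d' b) = socle_deg n d + 2 * (b * p ^ a)" for b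
  proof -
    have "(\<Sum>i=1..n-2. (?d' b i - 1)) = (\<Sum>i=1..n-2. (d i - 1))"
      using split(2,3) by (intro sum.cong) auto
    then show ?thesis
      unfolding deg using split(2,3) pos unfolding socle_deg_def split(1)
      by (simp add: mult_2 distrib_left ac_simps del: One_nat_def)
  qed
  have middle: "socle_deg n (?d' b) div 2 = socle_deg n d div 2 + b * p ^ a" for b
    unfolding deg' by simp
  have down: "WLP TYPE('k) n d" if "WLP TYPE('k) n (?d' b)" for b
  proof -
    from that obtain c :: "nat \<Rightarrow> 'k" where
      c: "surj_at n (?d' b) (linform n c) (socle_deg n d div 2 + b * p ^ a)"
      unfolding iff' middle by blast
    from surj_at_obtain_nonzero[OF c vars] obtain c' :: "nat \<Rightarrow> 'k" where
      c': "surj_at n (?d' b) (linform n c') (socle_deg n d div 2 + b * p ^ a)" "c' (n - 1) \<noteq> 0" "c' n \<noteq> 0"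
      by blast
    show ?thesis
      unfolding iff using two_variable_shift.surj_at_unshift[OF shift[OF c'(2,3)] c'(1)] by blast
  qed
  have up: "WLP TYPE('k) n (?d' b)"
    if "WLP TYPE('k) n d" and le: "(\<Sum>i=1..n-2. (d i - 1)) \<le> d (n - 1) + d n" for b
  proof -
    from that(1) obtain c :: "nat \<Rightarrow> 'k" where c: "surj_at n d (linform n c) (socle_deg n d div 2)"
      unfolding iff by blast
    from surj_at_obtain_nonzero[OF c vars] obtain c' :: "nat \<Rightarrow> 'k" where
      c': "surj_at n d (linform n c') (socle_deg n d div 2)" "c' (n - 1) \<noteq> 0" "c' n \<noteq> 0"
      by blast
    \<comment> \<open>With S the left-hand sum, N = d_(n-1) + d_n - 2 + S >= 2 S - 2, so S - 1 <= N
      div 2.\<close>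
    have "(\<Sum>i=1..n-2. (d i - 1)) \<le> Suc (socle_deg n d div 2)"
      using le pos unfolding deg by linarith
    then show ?thesis
      unfolding iff' middle
      using two_variable_shift.surj_at_shift[OF shift[OF c'(2,3)] c'(1)] by blast
  qed
  show ?thesis using down up by blast
qed

end
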